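(* For $n,k\geq 1$ there is a bijection $\zeta:\mathcal{Q}_n(k)\to\mathcal{F}_n(k)$ such that $\mathrm{ap}(\pi)=\mathrm{lleaf}(\zeta(\pi))-\mathrm{si}(\zeta(\pi))$ for every $\pi\in\mathcal{Q}_n(k)$. Moreover, $\pi\in\overline{\mathcal{Q}}_n(k)$ if and only if $\zeta(\pi)\in\overline{\mathcal{F}}_n(k)$.
   Context: A $k$-Stirling permutation of order $n$ is a word $\pi=\pi_1\cdots\pi_{kn}$ in which each of $1,\dots,n$ appears exactly $k$ times, such that $\pi_i=\pi_l$ with $i<l$ implies $\pi_j\geq\pi_i$ for all $i<j<l$; $\mathcal{Q}_n(k)$ is the set of them. $\overline{\mathcal{Q}}_n(k)=\{\pi\in\mathcal{Q}_n(k):\pi_1=\pi_2=\cdots=\pi_k\}$. An index $i$ is a longest ascent-plateau of $\pi$ if $\pi_i<\pi_{i+1}=\cdots=\pi_{i+k}$; $\mathrm{ap}(\pi)$ is the number of them. Trees: all trees are ordered (plane) rooted trees; the level of a node is its distance from the root (root at level 0); a leaf is a node with no children. An even $k$-ary tree is an ordered tree in which every node on an even level has exactly $k$ children. A pruned even $k$-ary tree is obtained from an even $k$-ary tree by deleting, for every even-level node all of whose children are leaves, all those children. An increasing pruned even $k$-ary tree on a set $M$ of positive integers is a pruned even $k$-ary tree whose nodes on even levels are labeled bijectively by $M$ (odd-level nodes unlabeled) such that labels increase along every path from the root downward and, for each node, the labels of its children increase from left to right. An increasing pruned even $k$-ary forest on $[n]$ is a sequence $(T_1,\dots,T_m)$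 of such trees whose label sets partition $[n]$ and whose root labels increase from left to right; $\mathcal{F}_n(k)$ is the set of them. A labeled leaf is a leaf on an even level; $\mathrm{lleaf}(F)$ is the total number of labeled leaves of $F$; a singleton is a one-node tree and $\mathrm{si}(F)$ is the number of singletons of $F$. $\overline{\mathcal{F}}_n(k)$ is the set of $F\in\mathcal{F}_n(k)$ such that either the rightmost tree of $F$ is a singleton or the first $k-1$ children (from the left) of the root of the rightmost tree of $F$ are leaves. *)

theory Defs
  imports Main "HOL-Library.Disjoint_Sets"
begin

text \<open>Words are lists, so the positions \<open>1, 2, \<dots>\<close> of the mathematics are shifted to \<open>0, 1, \<dots>\<close>.\<close>

definition stirling_perms :: "nat \<Rightarrow> nat \<Rightarrow> nat list set" where
  "stirling_perms n k = {\<pi>. length \<pi> = k * n \<and>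
     (\<forall>a\<in>{1..n}. count_list \<pi> a = k) \<and>
     (\<forall>i l. i < l \<and> l < length \<pi> \<and> \<pi> ! i = \<pi> ! l \<longrightarrow>
        (\<forall>j. i < j \<and> j < l \<longrightarrow> \<pi> ! j \<ge> \<pi> ! i))}"

definition stirling_perms_bar :: "nat \<Rightarrow> nat \<Rightarrow> nat list set" where
  "stirling_perms_bar n k = {\<pi> \<in> stirling_perms n k. \<forall>i<k. \<pi> ! i = \<pi> ! 0}"

definition ap :: "nat \<Rightarrow> nat list \<Rightarrow> nat" where
  "ap k \<pi> = card {i. i + k < length \<pi> \<and> \<pi> ! i < \<pi> ! (i + 1) \<and>
     (\<forall>j\<in>{1..k}. \<pi> ! (i + j) = \<pi> ! (i + 1))}"

datatype ptree = Node (label: "nat option") (children: "ptree list")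

definition is_leaf :: "ptree \<Rightarrow> bool" where
  "is_leaf t \<longleftrightarrow> children t = []"

text \<open>One entry per node: its level (when the root is at level \<open>d\<close>) and the subtree rooted at it.\<close>

fun nodes_from :: "nat \<Rightarrow> ptree \<Rightarrow> (nat \<times> ptree) list" where
  "nodes_from d (Node a ts) = (d, Node a ts) # concat (map (nodes_from (Suc d)) ts)"

abbreviation nodes :: "ptree \<Rightarrow> (nat \<times> ptree) list" where
  "nodes \<equiv> nodes_from 0"

definition even_kary :: "nat \<Rightarrow> ptree \<Rightarrow> bool" where
  "even_kary k t \<longleftrightarrow> (\<forall>(d, s) \<in> set (nodes t). even d \<longrightarrow> length (children s) = k)"

fun prune_from :: "nat \<Rightarrow> ptree \<Rightarrow> ptree" where
  "prune_from d (Node a ts) =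
     Node a (if even d \<and> (\<forall>t\<in>set ts. is_leaf t) then [] else map (prune_from (Suc d)) ts)"

text \<open>This concerns the shape only: \<open>even_kary\<close> ignores labels, and pruning leaves
  the labels of the surviving nodes unchanged.\<close>

definition pruned_even_kary :: "nat \<Rightarrow> ptree \<Rightarrow> bool" where
  "pruned_even_kary k t \<longleftrightarrow> (\<exists>t'. even_kary k t' \<and> t = prune_from 0 t')"

definition labels :: "ptree \<Rightarrow> nat list" where
  "labels t = List.map_filter (\<lambda>(d, s). label s) (nodes t)"

text \<open>In the monotonicity condition, \<open>(e, u)\<close> with \<open>e > 0\<close> ranges over the proper descendants
  of the node \<open>s\<close>.\<close>

definition increasing_tree :: "nat \<Rightarrow> nat set \<Rightarrow> ptree \<Rightarrow> bool" where
  "increasing_tree k M t \<longleftrightarrow>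
     pruned_even_kary k t \<and>
     (\<forall>(d, s) \<in> set (nodes t). label s \<noteq> None \<longleftrightarrow> even d) \<and>
     distinct (labels t) \<and> set (labels t) = M \<and>
     (\<forall>(d, s) \<in> set (nodes t). \<forall>(e, u) \<in> set (nodes s). e > 0 \<longrightarrow>
        (\<forall>x y. label s = Some x \<longrightarrow> label u = Some y \<longrightarrow> x < y)) \<and>
     (\<forall>(d, s) \<in> set (nodes t). sorted_wrt (<) (List.map_filter label (children s)))"

definition forests :: "nat \<Rightarrow> nat \<Rightarrow> ptree list set" where
  "forests n k = {F.
     (\<forall>T\<in>set F. \<exists>M. increasing_tree k M T) \<and>
     disjoint_family_on (\<lambda>i. set (labels (F ! i))) {..<length F} \<and>
     (\<Union>T\<in>set F. set (labels T)) = {1..n} \<and>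
     sorted_wrt (<) (map (\<lambda>T. the (label T)) F)}"

definition lleaf :: "ptree list \<Rightarrow> nat" where
  "lleaf F = (\<Sum>T\<leftarrow>F. length (filter (\<lambda>(d, s). even d \<and> is_leaf s) (nodes T)))"

definition si :: "ptree list \<Rightarrow> nat" where
  "si F = length (filter is_leaf F)"

definition forests_bar :: "nat \<Rightarrow> nat \<Rightarrow> ptree list set" where
  "forests_bar n k = {F \<in> forests n k.
     is_leaf (last F) \<or> (\<forall>t\<in>set (take (k - 1) (children (last F))). is_leaf t)}"

end

theory Submission
  imports Defs
begin

text \<open>
  A nonempty Stirling word with least letter \<open>m\<close> is \<open>W\<^sub>0 m W\<^sub>1 m \<dots> m W\<^sub>k\<close> with Stirling words \<open>W\<^sub>i\<close> on
  disjoint alphabets, and a nonempty forest with least label \<open>m\<close> consists of the \<open>k\<close> forests below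
  the root \<open>m\<close> of its first tree and the forest of the remaining trees: both are \<open>k + 1\<close> smaller
  objects of the same kind. The two decompositions are matched in two ways. In a forest below
  an unlabeled node, \<open>W\<^sub>0, \<dots>, W\<^sub>k\<^sub>-\<^sub>1\<close> go below \<open>m\<close> and \<open>W\<^sub>k\<close> is the rest; the word is then preceded by a
  smaller letter, and \<open>m\<close> heads a longest ascent-plateau iff \<open>W\<^sub>0, \<dots>, W\<^sub>k\<^sub>-\<^sub>1\<close> are empty, i.e. iff \<open>m\<close> is a
  leaf. At the top level, \<open>W\<^sub>1, \<dots>, W\<^sub>k\<close> go below \<open>m\<close> and \<open>W\<^sub>0\<close> is the rest; here \<open>m\<close> never heads an
  ascent-plateau, in accordance with the removal of singletons. The top-level rule is iterated on
  \<open>W\<^sub>0\<close>, so the last tree is read off the beginning of the word.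
\<close>

text \<open>\<open>N m [d\<^sub>0, \<dots>, d\<^sub>k]\<close> encodes both decompositions at the least letter \<open>m\<close>; \<open>E\<close> is the empty object.\<close>

datatype (dset: 'a) dtree = E | N 'a "'a dtree list"

text \<open>The \<open>k\<close> copies of \<open>m\<close> leave \<open>k + 1\<close> gaps, hence
  the length. Disjointness is imposed by position, so \<open>E\<close> may be repeated but a
  nonempty subtree may not.\<close>

fun valid :: "nat \<Rightarrow> nat dtree \<Rightarrow> bool" where
  "valid k E = True"
| "valid k (N m ds) = (length ds = Suc k \<and> (\<forall>d\<in>set ds. valid k d \<and> (\<forall>x\<in>dset d. m < x)) \<and>
     sorted_wrt (\<lambda>x y. disjnt (dset x) (dset y)) ds)"

subsection \<open>Stirling words\<close>

text \<open>Each piece but the first carries the \<open>m\<close> in front of it. In this form a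
  later piece \<open>v\<close> enters the counts of ascent-plateaus as \<open>m # v\<close>.\<close>

definition join :: "'a \<Rightarrow> 'a list list \<Rightarrow> 'a list" where
  "join m ws = hd ws @ concat (map ((#) m) (tl ws))"

fun word :: "'a dtree \<Rightarrow> 'a list" where
  "word E = []"
| "word (N m ds) = join m (map word ds)"

text \<open>Factorizations replace indices because they pass directly to infixes and concatenations;
  \<open>stirling_iff_nth\<close> gives the agreement.\<close>

definition stirling :: "nat list \<Rightarrow> bool" where
  "stirling w \<longleftrightarrow> (\<forall>xs a ys zs. w = xs @ a # ys @ a # zs \<longrightarrow> (\<forall>b\<in>set ys. a \<le> b))"

text \<open>The alphabet is left arbitrary, since the pieces of a Stirling permutation live on
  subsets of \<open>{1..n}\<close> that need not be intervals.\<close>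

definition stirling_word :: "nat \<Rightarrow> nat list \<Rightarrow> bool" where
  "stirling_word k w \<longleftrightarrow> stirling w \<and> (\<forall>a\<in>set w. count_list w a = k)"

lemma join_Cons: "join m (w # ws) = w @ concat (map ((#) m) ws)"
  by (simp add: join_def)

lemma join_Cons_Cons: "join m (w # v # ws) = w @ m # join m (v # ws)"
  by (simp add: join_def)

lemma set_join: "length ws \<ge> 2 \<Longrightarrow> set (join m ws) = insert m (\<Union>w\<in>set ws. set w)"
  by (cases ws rule: remdups_adj.cases) (auto simp: join_def)

lemma set_word:
  assumes "k \<ge> 1" "valid k d"
  shows "set (word d) = dset d"
  using assms(2)
proof (induction d)
  case (N m ds)
  then show ?case using assms(1) by (simp add: set_join)
qed simp

lemma word_eq_Nil_iff: "k \<ge> 1 \<Longrightarrow> valid k d \<Longrightarrow> word d = [] \<longleftrightarrow> d = E"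
  using set_word[of k d] by (cases d) auto

text \<open>Reading from the right, a letter \<open>m\<close> opens a new empty piece, and any other
  letter is put in front of the current first piece.\<close>

lemma ex_join:
  "\<exists>ws. w = join m ws \<and> (\<forall>x\<in>set ws. m \<notin> set x) \<and> length ws = Suc (count_list w m)"
proof (induction w)
  case Nil
  show ?case by (rule exI[of _ "[[]]"]) (simp add: join_def)
next
  case (Cons a w)
  then obtain ws where ws: "w = join m ws" "\<forall>x\<in>set ws. m \<notin> set x" "length ws = Suc (count_list w m)"
    by blast
  then obtain v vs where v: "ws = v # vs" by (cases ws) auto
  show ?case
  proof (cases "a = m")
    case True
    with ws v show ?thesis by (intro exI[of _ "[] # ws"]) (auto simp: join_def)
  next
    case False
    with ws v show ?thesis by (intro exI[of _ "(a # v) # vs"]) (auto simp: join_def)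
  qed
qed

lemma append_Cons_unique:
  assumes "x @ m # u = y @ m # v" "m \<notin> set x" "m \<notin> set y"
  shows "x = y \<and> u = v"
  using assms
proof (induction x arbitrary: y)
  case Nil
  then show ?case by (cases y) auto
next
  case (Cons a x)
  then show ?case by (cases y) auto
qed

lemma join_inject:
  assumes "length ws = length vs" "join m ws = join m vs"
    "\<forall>x\<in>set ws. m \<notin> set x" "\<forall>x\<in>set vs. m \<notin> set x"
  shows "ws = vs"
  using assms
proof (induction ws vs rule: list_induct2)
  case (Cons x xs y ys)
  show ?case
  proof (cases xs)
    case Nil
    with Cons show ?thesis by (auto simp: join_def)
  next
    case xs: (Cons x' xs')
    with Cons.hyps obtain y' ys' where ys: "ys = y' # ys'" by (cases ys) auto
    have "x = y \<and> join m xs = join m ys"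
      using Cons.prems unfolding xs ys join_Cons_Cons by (intro append_Cons_unique) auto
    with Cons.IH Cons.prems show ?thesis by auto
  qed
qed simp

text \<open>The word determines its alphabet, the least letter of which is the root; cutting at this
  letter recovers the words of the subtrees.\<close>

lemma word_inject:
  assumes "k \<ge> 1"
  shows "valid k d \<Longrightarrow> valid k e \<Longrightarrow> word d = word e \<Longrightarrow> d = e"
proof (induction d arbitrary: e)
  case E
  then show ?case using word_eq_Nil_iff[OF assms, of e] by simp
next
  case (N m ds)
  then obtain m' es where e: "e = N m' es"
    using word_eq_Nil_iff[OF assms, of "N m ds"] by (cases e) auto
  have eq: "dset (N m ds) = dset (N m' es)"
    using set_word[OF assms] N.prems e by metis
  \<comment> \<open>Otherwise each root would occur in a subtree of the other tree and so be
    strictly larger than the other root.\<close>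
  have "m = m'"
  proof (rule ccontr)
    assume "m \<noteq> m'"
    with eq have "m \<in> (\<Union>d\<in>set es. dset d)" "m' \<in> (\<Union>d\<in>set ds. dset d)" by auto
    with N.prems e have "m' < m" "m < m'" by auto
    then show False by simp
  qed
  have sub: "\<forall>x\<in>set (map word cs). m \<notin> set x" if "valid k (N m cs)" for cs
    using that set_word[OF assms] by fastforce
  have "map word ds = map word es"
    using N.prems e \<open>m = m'\<close> by (intro join_inject[of _ _ m] sub) simp_all
  then have "ds = es"
    using N.IH N.prems e
    by (intro nth_equalityI) (auto dest!: map_eq_imp_length_eq simp: list_eq_iff_nth_eq)
  with e \<open>m = m'\<close> show ?case by simp
qed

section \<open>The Stirling condition under cutting at the least letter\<close>

lemma stirling_infix: "stirling (xs @ w @ ys) \<Longrightarrow> stirling w"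
  unfolding stirling_def by (metis append.assoc append_Cons)

text \<open>A letter common to \<open>u\<close> and \<open>v\<close> would enclose the smaller
  \<open>m\<close>. Conversely, disjointness puts two equal letters other than \<open>m\<close> on
  the same side. The bound on \<open>v\<close> is weak so that \<open>v\<close> may contain further
  copies of \<open>m\<close>.\<close>

lemma stirling_append_Cons:
  assumes "\<forall>x\<in>set u. m < x" "\<forall>x\<in>set v. m \<le> x"
  shows "stirling (u @ m # v) \<longleftrightarrow> stirling u \<and> stirling v \<and> disjnt (set u) (set v)"
proof
  assume st: "stirling (u @ m # v)"
  have "disjnt (set u) (set v)"
  proof (rule ccontr)
    assume "\<not> ?thesis"
    then obtain a where a: "a \<in> set u" "a \<in> set v" by (auto simp: disjnt_iff)
    then obtain p q r s where "u = p @ a # q" "v = r @ a # s" by (metis split_list)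
    then have "u @ m # v = p @ a # (q @ m # r) @ a # s" by simp
    with st have "a \<le> m" unfolding stirling_def by (metis in_set_conv_decomp)
    with a assms show False by auto
  qed
  with st show "stirling u \<and> stirling v \<and> disjnt (set u) (set v)"
    using stirling_infix[of "[]" u "m # v"] stirling_infix[of "u @ [m]" v "[]"] by simp
next
  assume st: "stirling u \<and> stirling v \<and> disjnt (set u) (set v)"
  show "stirling (u @ m # v)"
    unfolding stirling_def
  proof (intro allI impI ballI)
    fix xs a ys zs b
    assume w: "u @ m # v = xs @ a # ys @ a # zs" and b: "b \<in> set ys"
    show "a \<le> b"
    proof (cases "a = m")
      case True
      have "b \<in> set (u @ m # v)" unfolding w using b by simp
      with assms True show ?thesis by auto
    next
      case False
      \<comment> \<open>The first copy of \<open>a\<close> lies in \<open>u\<close> or beyond it; in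
        the former case the second copy is located relative to the displayed \<open>m\<close> in the
        same way.\<close>
      obtain us where "u = xs @ us \<and> us @ m # v = a # ys @ a # zs \<or>
          u @ us = xs \<and> m # v = us @ a # ys @ a # zs"
        using w unfolding append_eq_append_conv2 by blast
      with False consider (in_u) p where "u = xs @ a # p" "ys @ a # zs = p @ m # v"
        | (not_u) p where "xs = u @ p" "m # v = p @ a # ys @ a # zs"
        by (cases us) auto
      then show ?thesis
      proof cases
        case in_u
        obtain us where "ys = p @ us \<and> us @ a # zs = m # v \<or> ys @ us = p \<and> a # zs = us @ m # v"
          using in_u(2) unfolding append_eq_append_conv2 by blast
        with False consider (l) q where "p = ys @ a # q" | (r) "a \<in> set v"
          by (cases us) auto
        then show ?thesis
        proof cases
          case l
          with in_u st b show ?thesis unfolding stirling_def by auto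
        next
          case r
          with in_u st show ?thesis by (auto simp: disjnt_iff)
        qed
      next
        case not_u
        with False obtain p' where "v = p' @ a # ys @ a # zs" by (cases p) auto
        with st b show ?thesis unfolding stirling_def by blast
      qed
    qed
  qed
qed

lemma stirling_join:
  assumes "ws \<noteq> []" "\<forall>w\<in>set ws. \<forall>x\<in>set w. m < x"
  shows "stirling (join m ws) \<longleftrightarrow>
    (\<forall>w\<in>set ws. stirling w) \<and> sorted_wrt (\<lambda>u v. disjnt (set u) (set v)) ws"
  using assms
proof (induction ws rule: list_nonempty_induct)
  case (single x)
  then show ?case by (simp add: join_def)
next
  case (cons x xs)
  then obtain y ys where xs: "xs = y # ys" by (cases xs) auto
  have sub: "set (join m xs) \<subseteq> insert m (\<Union>w\<in>set xs. set w)" "(\<Union>w\<in>set xs. set w) \<subseteq> set (join m xs)"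
    by (auto simp: xs join_def)
  have "stirling (join m (x # xs)) \<longleftrightarrow>
      stirling x \<and> stirling (join m xs) \<and> disjnt (set x) (set (join m xs))"
    unfolding xs join_Cons_Cons using cons.prems sub
    by (intro stirling_append_Cons) (fastforce simp: xs)+
  moreover have "disjnt (set x) (set (join m xs)) \<longleftrightarrow> (\<forall>w\<in>set xs. disjnt (set x) (set w))"
    using sub cons.prems by (fastforce simp: disjnt_iff)
  ultimately show ?case using cons by auto
qed

lemma count_list_join:
  "ws \<noteq> [] \<Longrightarrow> count_list (join m ws) a =
    (\<Sum>w\<leftarrow>ws. count_list w a) + (if a = m then length ws - 1 else 0)"
proof (induction ws rule: list_nonempty_induct)
  case (single x)
  then show ?case by (simp add: join_def)
next
  case (cons x xs)
  then show ?case by (cases xs) (auto simp: join_Cons_Cons)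
qed

lemma sum_list_count_disjoint:
  assumes "sorted_wrt (\<lambda>u v. disjnt (set u) (set v)) ws" "w \<in> set ws" "a \<in> set w"
  shows "(\<Sum>w\<leftarrow>ws. count_list w a) = count_list w a"
  using assms
proof (induction ws)
  case (Cons v ws)
  show ?case
  proof (cases "w \<in> set ws")
    case True
    with Cons have "a \<notin> set v" by (auto simp: disjnt_iff)
    with Cons True show ?thesis by (simp add: count_list_0_iff)
  next
    case False
    with Cons have "w = v" "\<forall>u\<in>set ws. a \<notin> set u" by (auto simp: disjnt_iff)
    then show ?thesis by (auto simp: sum_list_eq_0_iff count_list_0_iff)
  qed
qed simp

text \<open>The separators account for the \<open>k\<close> copies of \<open>m\<close>, and every
  other letter has all its copies in one piece. The latter rests on disjointness, which
  \<open>stirling_join\<close> supplies from either side.\<close>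

lemma stirling_word_join:
  assumes "k \<ge> 1" "length ws = Suc k" "\<forall>w\<in>set ws. \<forall>x\<in>set w. m < x"
  shows "stirling_word k (join m ws) \<longleftrightarrow>
    (\<forall>w\<in>set ws. stirling_word k w) \<and> sorted_wrt (\<lambda>u v. disjnt (set u) (set v)) ws"
proof -
  have ne: "ws \<noteq> []" using assms by auto
  have "(\<forall>a\<in>set (join m ws). count_list (join m ws) a = k) \<longleftrightarrow>
      (\<forall>w\<in>set ws. \<forall>a\<in>set w. count_list w a = k)"
    if s: "sorted_wrt (\<lambda>u v. disjnt (set u) (set v)) ws"
  proof -
    have "(\<Sum>w\<leftarrow>ws. count_list w m) = 0"
      using assms by (auto simp: sum_list_eq_0_iff count_list_0_iff)
    then have "count_list (join m ws) m = k" using assms by (simp add: count_list_join ne)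
    moreover have "count_list (join m ws) a = count_list w a" if "w \<in> set ws" "a \<in> set w" for a w
      using that assms sum_list_count_disjoint[OF s that] by (auto simp: count_list_join ne)
    ultimately show ?thesis using assms by (auto simp: set_join)
  qed
  then show ?thesis unfolding stirling_word_def stirling_join[OF ne assms(3)] by blast
qed

lemma stirling_word_word:
  assumes "k \<ge> 1"
  shows "valid k d \<Longrightarrow> stirling_word k (word d)"
proof (induction d)
  case E
  then show ?case by (simp add: stirling_word_def stirling_def)
next
  case (N m ds)
  have *: "\<forall>w\<in>set (map word ds). \<forall>x\<in>set w. m < x"
    using N.prems set_word[OF assms] by auto
  have "sorted_wrt (\<lambda>u v. disjnt (set (word u)) (set (word v))) ds"
    using N.prems set_word[OF assms] by (auto intro: sorted_wrt_mono_rel[rotated])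
  with N * show ?case by (simp add: stirling_word_join[OF assms] sorted_wrt_map)
qed

text \<open>The least letter occurs \<open>k\<close> times, so it cuts the word into
  \<open>k + 1\<close> shorter Stirling words, to which induction on the length applies.\<close>

lemma word_surj:
  assumes "k \<ge> 1"
  shows "stirling_word k w \<Longrightarrow> \<exists>d. valid k d \<and> word d = w"
proof (induction w rule: length_induct)
  case (1 w)
  show ?case
  proof (cases "w = []")
    case True
    then show ?thesis by (intro exI[of _ E]) simp
  next
    case False
    define m where "m = Min (set w)"
    have m: "m \<in> set w" "\<forall>x\<in>set w. m \<le> x" using False by (auto simp: m_def)
    then have c: "count_list w m = k" using "1.prems" by (simp add: stirling_word_def)
    obtain ws where ws: "w = join m ws" "\<forall>x\<in>set ws. m \<notin> set x" "length ws = Suc k"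
      using ex_join[of w m] c by auto
    have sw: "set w = insert m (\<Union>w\<in>set ws. set w)"
      using set_join[of ws m] ws assms by simp
    have gt: "\<forall>v\<in>set ws. \<forall>x\<in>set v. m < x"
      using sw m(2) ws(2) by (metis UN_I insertI2 le_neq_implies_less)
    have st: "\<forall>w\<in>set ws. stirling_word k w" "sorted_wrt (\<lambda>u v. disjnt (set u) (set v)) ws"
      using "1.prems" stirling_word_join[OF assms ws(3) gt] unfolding ws(1) by auto
    \<comment> \<open>There are at least two pieces, hence at least one separator outside
      \<open>v\<close>.\<close>
    have "length v < length w" if "v \<in> set ws" for v
    proof -
      from that obtain as bs where s: "ws = as @ v # bs" by (metis split_list)
      then show ?thesis using ws(1,3) assms
        by (cases as; cases bs) (auto simp: join_def)
    qed
    then have "\<exists>d. valid k d \<and> word d = v" if "v \<in> set ws" for v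
      using "1.IH" st(1) that by blast
    then obtain f where f: "\<forall>v\<in>set ws. valid k (f v) \<and> word (f v) = v" by metis
    then have ds: "\<forall>v\<in>set ws. dset (f v) = set v" using set_word[OF assms] by metis
    have "valid k (N m (map f ws))"
      using ws(3) f ds gt st(2) by (auto simp: sorted_wrt_map intro: sorted_wrt_mono_rel[rotated])
    moreover have "word (N m (map f ws)) = w"
      using f ws(1) by (simp add: comp_def cong: map_cong)
    ultimately show ?thesis by blast
  qed
qed

section \<open>Agreement with the index-based definition of Stirling permutations\<close>

lemma stirling_iff_nth:
  "stirling w \<longleftrightarrow> (\<forall>i l. i < l \<and> l < length w \<and> w ! i = w ! l \<longrightarrow>
     (\<forall>j. i < j \<and> j < l \<longrightarrow> w ! j \<ge> w ! i))" (is "_ \<longleftrightarrow> ?R")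
proof
  assume st: "stirling w"
  show ?R
  proof (intro allI impI, elim conjE)
    fix i l j
    assume *: "i < l" "l < length w" "w ! i = w ! l" "i < j" "j < l"
    define ys where "ys = take (l - Suc i) (drop (Suc i) w)"
    have "drop (Suc i) w = ys @ w ! l # drop (Suc l) w"
      using * id_take_nth_drop[of "l - Suc i" "drop (Suc i) w"] by (simp add: ys_def)
    then have "w = take i w @ w ! i # ys @ w ! i # drop (Suc l) w"
      using * id_take_nth_drop[of i w] by simp
    moreover have "w ! j \<in> set ys"
      using * unfolding ys_def by (auto simp: in_set_conv_nth intro!: exI[of _ "j - Suc i"])
    ultimately show "w ! i \<le> w ! j" using st unfolding stirling_def by blast
  qed
next
  assume R: ?R
  show "stirling w"
    unfolding stirling_def
  proof (intro allI impI ballI)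
    fix xs a ys zs b
    assume w: "w = xs @ a # ys @ a # zs" and "b \<in> set ys"
    then obtain q where q: "q < length ys" "ys ! q = b" by (auto simp: in_set_conv_nth)
    have "w ! length xs = a" "w ! (length xs + Suc (length ys)) = a" "w ! (length xs + Suc q) = b"
      using q by (simp_all add: w nth_append)
    then show "a \<le> b"
      using R[rule_format, of "length xs" "length xs + Suc (length ys)" "length xs + Suc q"] q w
      by simp
  qed
qed

lemma stirling_perms_eq:
  assumes "k \<ge> 1"
  shows "stirling_perms n k = {w. stirling_word k w \<and> set w = {1..n}}"
proof -
  have "length w = k * n \<and> (\<forall>a\<in>{1..n}. count_list w a = k) \<longleftrightarrow>
      (\<forall>a\<in>set w. count_list w a = k) \<and> set w = {1..n}" for w
  proof
    assume *: "length w = k * n \<and> (\<forall>a\<in>{1..n}. count_list w a = k)"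
    then have sub: "{1..n} \<subseteq> set w" using assms count_list_0_iff by (metis not_one_le_zero subsetI)
    \<comment> \<open>The letters from \<open>1\<close> to \<open>n\<close> already use up the
      length \<open>k * n\<close>, so no multiplicity is left for any other letter.\<close>
    have "sum (count_list w) (set w) = sum (count_list w) {1..n}"
      using * by (simp add: sum_count_set)
    then have "sum (count_list w) (set w - {1..n}) = 0"
      using sum.subset_diff[OF sub, of "count_list w"] by simp
    then have "set w = {1..n}" using sub by (auto simp: count_list_0_iff)
    with * show "(\<forall>a\<in>set w. count_list w a = k) \<and> set w = {1..n}" by simp
  next
    assume *: "(\<forall>a\<in>set w. count_list w a = k) \<and> set w = {1..n}"
    have "length w = sum (count_list w) (set w)" by (simp add: sum_count_set)
    also have "\<dots> = sum (\<lambda>_. k) {1..n}" using * by (intro sum.cong) auto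
    finally show "length w = k * n \<and> (\<forall>a\<in>{1..n}. count_list w a = k)" using * by simp
  qed
  then show ?thesis
    unfolding stirling_perms_def stirling_word_def stirling_iff_nth by auto
qed

lemma bij_betw_word:
  assumes "k \<ge> 1"
  shows "bij_betw word {d. valid k d \<and> dset d = {1..n}} (stirling_perms n k)"
  unfolding bij_betw_def
proof
  show "inj_on word {d. valid k d \<and> dset d = {1..n}}"
    using word_inject[OF assms] by (auto intro: inj_onI)
  show "word ` {d. valid k d \<and> dset d = {1..n}} = stirling_perms n k"
  proof (intro equalityI subsetI)
    fix w assume "w \<in> stirling_perms n k"
    then have w: "stirling_word k w" "set w = {1..n}" by (simp_all add: stirling_perms_eq[OF assms])
    then obtain d where "valid k d" "word d = w" using word_surj[OF assms] by blast
    moreover from this have "dset d = {1..n}" using w set_word[OF assms, of d] by simp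
    ultimately show "w \<in> word ` {d. valid k d \<and> dset d = {1..n}}" by blast
  next
    fix w assume "w \<in> word ` {d. valid k d \<and> dset d = {1..n}}"
    then obtain d where "valid k d" "dset d = {1..n}" "w = word d" by blast
    then show "w \<in> stirling_perms n k"
      using stirling_word_word[OF assms, of d] set_word[OF assms, of d]
      unfolding stirling_perms_eq[OF assms] by simp
  qed
qed

subsection \<open>Increasing forests\<close>

text \<open>This describes the result of pruning without reference to the unpruned tree; the flag is
  the parity of the level. An even-level node with only leaves below it is exactly what pruning
  rules out.\<close>

fun pruned_shape :: "nat \<Rightarrow> bool \<Rightarrow> ptree \<Rightarrow> bool" where
  "pruned_shape k b (Node a ts) \<longleftrightarrow>
     (b \<longrightarrow> ts = [] \<or> length ts = k \<and> (\<exists>t\<in>set ts. \<not> is_leaf t)) \<and>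
     (\<forall>t\<in>set ts. pruned_shape k (\<not> b) t)"

text \<open>Pruning removes children of even-level nodes only. Hence the test at an even-level node,
  whether all its children are leaves, gives the same answer before and after pruning below
  it.\<close>

lemma is_leaf_prune_odd: "odd d \<Longrightarrow> is_leaf (prune_from d t) \<longleftrightarrow> is_leaf t"
  by (cases t) (simp add: is_leaf_def)

lemma pruned_shape_prune_from:
  "\<forall>(d', s) \<in> set (nodes_from d t). even d' \<longrightarrow> length (children s) = k \<Longrightarrow>
    pruned_shape k (even d) (prune_from d t)"
proof (induction t arbitrary: d)
  case (Node a ts)
  have "pruned_shape k (even (Suc d)) (prune_from (Suc d) t)" if "t \<in> set ts" for t
    using Node.IH[OF that, of "Suc d"] Node.prems that by simp
  moreover have "even d \<Longrightarrow> length ts = k" using Node.prems by simp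
  ultimately show ?case by (auto simp: is_leaf_prune_odd)
qed

text \<open>Pruning is undone by restoring the deleted leaves below each childless even-level
  node.\<close>

lemma ex_prune_from:
  "pruned_shape k (even d) t \<Longrightarrow>
    \<exists>t'. (\<forall>(d', s) \<in> set (nodes_from d t'). even d' \<longrightarrow> length (children s) = k) \<and>
      t = prune_from d t'"
proof (induction t arbitrary: d)
  case (Node a ts)
  have "\<exists>t'. (\<forall>(d', s) \<in> set (nodes_from (Suc d) t'). even d' \<longrightarrow> length (children s) = k) \<and>
      t = prune_from (Suc d) t'" if "t \<in> set ts" for t
    using Node that by simp
  then obtain f where f: "\<And>t. t \<in> set ts \<Longrightarrow>
      (\<forall>(d', s) \<in> set (nodes_from (Suc d) (f t)). even d' \<longrightarrow> length (children s) = k) \<and>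
      prune_from (Suc d) (f t) = t" by metis
  show ?case
  proof (cases "even d \<and> ts = []")
    case True
    then show ?thesis
      \<comment> \<open>The \<open>k\<close> restored leaves are unlabeled and are deleted again by
        pruning.\<close>
      by (intro exI[of _ "Node a (replicate k (Node None []))"]) (auto simp: is_leaf_def)
  next
    case False
    \<comment> \<open>A non-leaf child survives in the reconstruction, so pruning does not cut off
      the children of this node.\<close>
    have "\<not> is_leaf (f t)" if "even d" "t \<in> set ts" "\<not> is_leaf t" for t
      using that f is_leaf_prune_odd[of "Suc d" "f t"] by simp
    with False f Node.prems show ?thesis
      by (intro exI[of _ "Node a (map f ts)"]) (auto simp: comp_def intro!: map_idI[symmetric])
  qed
qed

lemma pruned_even_kary_iff: "pruned_even_kary k t \<longleftrightarrow> pruned_shape k True t"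
  using pruned_shape_prune_from[of 0 _ k] ex_prune_from[of k 0 t]
  by (auto simp: pruned_even_kary_def even_kary_def)

section \<open>Labels, and increasing trees described by recursion\<close>

lemma map_snd_nodes_from: "map snd (nodes_from d t) = map snd (nodes_from d' t)"
proof (induction t arbitrary: d d')
  case (Node a ts)
  then have "map (\<lambda>t. map snd (nodes_from (Suc d) t)) ts = map (\<lambda>t. map snd (nodes_from (Suc d') t)) ts"
    by (intro map_cong[OF refl]) blast
  from arg_cong[OF this, of concat] show ?case by (simp add: map_concat comp_def del: map_eq_conv)
qed

lemma map_filter_append: "List.map_filter f (xs @ ys) = List.map_filter f xs @ List.map_filter f ys"
  by (simp add: List.map_filter_def)

lemma map_filter_concat: "List.map_filter f (concat xss) = concat (map (List.map_filter f) xss)"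
  by (induction xss) (simp_all add: map_filter_append List.map_filter_simps)

lemma labels_nodes_from: "List.map_filter (\<lambda>(d, s). label s) (nodes_from d t) = labels t"
proof -
  have *: "List.map_filter (\<lambda>(d, s). label s) xs = List.map_filter label (map snd xs)"
    for xs :: "(nat \<times> ptree) list"
    by (induction xs) (auto simp: List.map_filter_simps split: option.split)
  show ?thesis unfolding labels_def * using map_snd_nodes_from by metis
qed

lemma labels_Node: "labels (Node a ts) = (case a of None \<Rightarrow> [] | Some x \<Rightarrow> [x]) @ concat (map labels ts)"
proof -
  have "labels (Node a ts) = List.map_filter (\<lambda>(d, s). label s) ([(0, Node a ts)] @ concat (map (nodes_from (Suc 0)) ts))"
    by (simp add: labels_def)
  then show ?thesis
    by (simp only: map_filter_append map_filter_concat)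
      (auto simp: List.map_filter_simps comp_def labels_nodes_from split: option.split)
qed

lemma set_labels: "y \<in> set (labels t) \<longleftrightarrow> (\<exists>(e, u) \<in> set (nodes_from d t). label u = Some y)"
  unfolding labels_nodes_from[of d t, symmetric] by (force simp: List.map_filter_def)

text \<open>The flag tells whether the root is on an even level.\<close>

fun good :: "nat \<Rightarrow> bool \<Rightarrow> ptree \<Rightarrow> bool" where
  "good k b (Node a ts) \<longleftrightarrow>
     (b \<longrightarrow> ts = [] \<or> length ts = k \<and> (\<exists>t\<in>set ts. \<not> is_leaf t)) \<and>
     (\<forall>t\<in>set ts. good k (\<not> b) t) \<and>
     (a \<noteq> None \<longleftrightarrow> b) \<and>
     (\<forall>x. a = Some x \<longrightarrow> (\<forall>t\<in>set ts. \<forall>y\<in>set (labels t). x < y)) \<and>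
     sorted_wrt (\<lambda>s t. disjnt (set (labels s)) (set (labels t))) ts \<and>
     sorted_wrt (<) (List.map_filter label ts)"

lemma distinct_concat_map_iff:
  "distinct (concat (map f xs)) \<longleftrightarrow>
    (\<forall>x\<in>set xs. distinct (f x)) \<and> sorted_wrt (\<lambda>x y. disjnt (set (f x)) (set (f y))) xs"
  by (induction xs) (auto simp: disjnt_iff)

lemma ball_nodes_from_Node:
  "(\<forall>(d', s) \<in> set (nodes_from d (Node a ts)). Q d' s) \<longleftrightarrow>
    Q d (Node a ts) \<and> (\<forall>t\<in>set ts. \<forall>(d', s) \<in> set (nodes_from (Suc d) t). Q d' s)"
  by auto

lemma nodes_from_level: "(e, u) \<in> set (nodes_from d t) \<Longrightarrow> d \<le> e"
  by (induction t arbitrary: d) fastforce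

text \<open>All nodes inside a child have level at least 1, so \<open>e > 0\<close> excludes the
  root alone, and the proper descendants are the nodes of the children.\<close>

lemma label_less_descendants_iff:
  "(\<forall>(e, u) \<in> set (nodes (Node a ts)). e > 0 \<longrightarrow> (\<forall>x y. a = Some x \<longrightarrow> label u = Some y \<longrightarrow> x < y)) \<longleftrightarrow>
    (\<forall>x. a = Some x \<longrightarrow> (\<forall>t\<in>set ts. \<forall>y\<in>set (labels t). x < y))"
proof -
  have "(\<forall>(e, u) \<in> set (nodes_from (Suc 0) t). e > 0 \<longrightarrow> (\<forall>x y. a = Some x \<longrightarrow> label u = Some y \<longrightarrow> x < y)) \<longleftrightarrow>
      (\<forall>x. a = Some x \<longrightarrow> (\<forall>y\<in>set (labels t). x < y))" for t
    using nodes_from_level[of _ _ "Suc 0" t] by (fastforce simp: set_labels[of _ _ "Suc 0"])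
  then show ?thesis unfolding ball_nodes_from_Node by auto
qed

text \<open>Every condition over all nodes splits into one at the root and the same one for the
  children, with the level advanced by one; \<open>good\<close> collects the conditions at the
  root.\<close>

lemma good_iff:
  "good k (even d) t \<longleftrightarrow> pruned_shape k (even d) t \<and>
    (\<forall>(d, s) \<in> set (nodes_from d t). label s \<noteq> None \<longleftrightarrow> even d) \<and>
    distinct (labels t) \<and>
    (\<forall>(d, s) \<in> set (nodes_from d t). \<forall>(e, u) \<in> set (nodes s). e > 0 \<longrightarrow>
        (\<forall>x y. label s = Some x \<longrightarrow> label u = Some y \<longrightarrow> x < y)) \<and>
    (\<forall>(d, s) \<in> set (nodes_from d t). sorted_wrt (<) (List.map_filter label (children s)))"
proof -
  define A where "A = (\<lambda>d t. \<forall>(d, s) \<in> set (nodes_from d t). label s \<noteq> None \<longleftrightarrow> even d)"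
  define B where "B = (\<lambda>d t. \<forall>(d, s) \<in> set (nodes_from d t). \<forall>(e, u) \<in> set (nodes s). e > 0 \<longrightarrow>
        (\<forall>x y. label s = Some x \<longrightarrow> label u = Some y \<longrightarrow> x < y))"
  define C where "C = (\<lambda>d t. \<forall>(d, s) \<in> set (nodes_from d t). sorted_wrt (<) (List.map_filter label (children s)))"
  have A: "A d (Node a ts) \<longleftrightarrow> (a \<noteq> None \<longleftrightarrow> even d) \<and> (\<forall>t\<in>set ts. A (Suc d) t)" for d a ts
    unfolding A_def ball_nodes_from_Node by simp
  have B: "B d (Node a ts) \<longleftrightarrow> (\<forall>x. a = Some x \<longrightarrow> (\<forall>t\<in>set ts. \<forall>y\<in>set (labels t). x < y)) \<and>
      (\<forall>t\<in>set ts. B (Suc d) t)" for d a ts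
    unfolding B_def by (subst ball_nodes_from_Node) (simp only: ptree.sel label_less_descendants_iff)
  have C: "C d (Node a ts) \<longleftrightarrow> sorted_wrt (<) (List.map_filter label ts) \<and> (\<forall>t\<in>set ts. C (Suc d) t)"
    for d a ts
    unfolding C_def ball_nodes_from_Node by simp
  have "good k (even d) t \<longleftrightarrow> pruned_shape k (even d) t \<and> A d t \<and> distinct (labels t) \<and> B d t \<and> C d t"
  proof (induction t arbitrary: d)
    case (Node a ts)
    have IH: "good k (odd d) t \<longleftrightarrow> pruned_shape k (odd d) t \<and> A (Suc d) t \<and> distinct (labels t) \<and>
        B (Suc d) t \<and> C (Suc d) t" if "t \<in> set ts" for t
      using Node[of t "Suc d"] that by simp
    \<comment> \<open>The root label is smaller than every label below it and cannot recur, so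
      distinctness concerns only the children.\<close>
    have dl: "distinct (labels (Node a ts)) \<longleftrightarrow>
        (\<forall>t\<in>set ts. distinct (labels t)) \<and> sorted_wrt (\<lambda>s t. disjnt (set (labels s)) (set (labels t))) ts"
      if "\<forall>x. a = Some x \<longrightarrow> (\<forall>t\<in>set ts. \<forall>y\<in>set (labels t). x < y)"
      using that by (cases a) (auto simp: labels_Node distinct_concat_map_iff)
    show ?case
      unfolding A B C good.simps pruned_shape.simps using IH dl by blast
  qed
  then show ?thesis unfolding A_def B_def C_def .
qed

lemma increasing_tree_iff: "increasing_tree k M t \<longleftrightarrow> good k True t \<and> set (labels t) = M"
  using good_iff[of k 0 t] by (auto simp: increasing_tree_def pruned_even_kary_iff)

section \<open>Forests and their decomposition at the first root\<close>

definition flabels :: "ptree list \<Rightarrow> nat set" where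
  "flabels F = (\<Union>T\<in>set F. set (labels T))"

definition good_forest :: "nat \<Rightarrow> ptree list \<Rightarrow> bool" where
  "good_forest k F \<longleftrightarrow> (\<forall>T\<in>set F. good k True T) \<and>
     sorted_wrt (\<lambda>s t. disjnt (set (labels s)) (set (labels t))) F \<and>
     sorted_wrt (<) (map (\<lambda>T. the (label T)) F)"

lemma good_label: "good k b t \<Longrightarrow> label t \<noteq> None \<longleftrightarrow> b"
  by (cases t) simp

text \<open>A forest is the list of children of an unlabeled node. These children are on even
  levels, hence all labeled, and \<open>List.map_filter\<close> drops none of them.\<close>

lemma good_Node_None: "good k False (Node None F) \<longleftrightarrow> good_forest k F"
proof -
  have "List.map_filter label F = map (\<lambda>T. the (label T)) F" if "\<forall>T\<in>set F. good k True T"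
  proof -
    have "filter (\<lambda>T. label T \<noteq> None) F = F" using that good_label[of k True] by (auto intro: filter_True)
    then show ?thesis by (simp add: List.map_filter_def comp_def)
  qed
  then show ?thesis by (auto simp: good_forest_def)
qed

lemma forests_eq: "forests n k = {F. good_forest k F \<and> flabels F = {1..n}}"
proof -
  have "disjoint_family_on (\<lambda>i. set (labels (F ! i))) {..<length F} \<longleftrightarrow>
      sorted_wrt (\<lambda>s t. disjnt (set (labels s)) (set (labels t))) F" for F
  proof
    assume "disjoint_family_on (\<lambda>i. set (labels (F ! i))) {..<length F}"
    then show "sorted_wrt (\<lambda>s t. disjnt (set (labels s)) (set (labels t))) F"
      by (simp add: sorted_wrt_iff_nth_less disjoint_family_on_def disjnt_def)
  next
    assume s: "sorted_wrt (\<lambda>s t. disjnt (set (labels s)) (set (labels t))) F"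
    show "disjoint_family_on (\<lambda>i. set (labels (F ! i))) {..<length F}"
      unfolding disjoint_family_on_def
    proof (intro ballI impI)
      fix i j assume "i \<in> {..<length F}" "j \<in> {..<length F}" "i \<noteq> j"
      with s show "set (labels (F ! i)) \<inter> set (labels (F ! j)) = {}"
        by (cases i j rule: linorder_cases) (auto simp: sorted_wrt_iff_nth_less disjnt_iff)
    qed
  qed
  then show ?thesis
    by (auto simp: forests_def good_forest_def flabels_def increasing_tree_iff)
qed

text \<open>The case distinction carries out the pruning: if all forests are empty, the unlabeled
  children would all be leaves.\<close>

definition mk_tree :: "nat \<Rightarrow> ptree list list \<Rightarrow> ptree" where
  "mk_tree m Fs = Node (Some m) (if \<forall>F\<in>set Fs. F = [] then [] else map (Node None) Fs)"

lemma labels_Node_None: "set (labels (Node None F)) = flabels F"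
  by (simp add: labels_Node flabels_def)

lemma set_labels_mk_tree: "set (labels (mk_tree m Fs)) = insert m (\<Union>F\<in>set Fs. flabels F)"
  by (auto simp: mk_tree_def labels_Node labels_Node_None flabels_def)

lemma label_mk_tree [simp]: "label (mk_tree m Fs) = Some m"
  by (simp add: mk_tree_def)

lemma good_mk_tree:
  assumes "length Fs = k"
  shows "good k True (mk_tree m Fs) \<longleftrightarrow>
    (\<forall>F\<in>set Fs. good_forest k F \<and> (\<forall>x\<in>flabels F. m < x)) \<and>
    sorted_wrt (\<lambda>F G. disjnt (flabels F) (flabels G)) Fs"
proof (cases "\<forall>F\<in>set Fs. F = []")
  case True
  then have *: "flabels F = {}" "good_forest k F" if "F \<in> set Fs" for F
    using that by (auto simp: flabels_def good_forest_def)
  then have "sorted_wrt (\<lambda>F G. disjnt (flabels F) (flabels G)) Fs"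
    by (simp add: sorted_wrt_iff_nth_less)
  moreover have "mk_tree m Fs = Node (Some m) []" using True by (simp add: mk_tree_def)
  ultimately show ?thesis using * by (simp add: List.map_filter_simps)
next
  case False
  have "List.map_filter label (map (Node None) Fs) = []" by (simp add: List.map_filter_def)
  moreover have "mk_tree m Fs = Node (Some m) (map (Node None) Fs)"
    using False by (auto simp: mk_tree_def)
  moreover have "\<exists>t\<in>set (map (Node None) Fs). \<not> is_leaf t"
    using False by (auto simp: is_leaf_def)
  ultimately show ?thesis using assms
    by (simp add: good.simps[of k True] good_Node_None labels_Node_None sorted_wrt_map ball_conj_distrib
        del: good.simps)
qed

lemma good_imp_mk_tree:
  assumes "good k True t"
  shows "\<exists>m Fs. length Fs = k \<and> t = mk_tree m Fs"
proof -
  obtain m ts where t: "t = Node (Some m) ts" using assms by (cases t) auto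
  show ?thesis
  proof (cases "ts = []")
    case True
    \<comment> \<open>A bare root stands for \<open>k\<close> empty forests.\<close>
    with t show ?thesis by (intro exI[of _ m] exI[of _ "replicate k []"]) (simp add: mk_tree_def)
  next
    case False
    have "Node None (children s) = s" if "s \<in> set ts" for s
      using assms that good_label[of k False s] by (cases s) (auto simp: t)
    then have "map (\<lambda>s. Node None (children s)) ts = ts" by (simp add: map_idI)
    with False assms t show ?thesis
      by (intro exI[of _ m] exI[of _ "map children ts"]) (auto simp: mk_tree_def comp_def is_leaf_def)
  qed
qed

text \<open>A singleton forgets how many empty forests it came from; the equality of lengths
  restores that number.\<close>

lemma mk_tree_inject:
  assumes "mk_tree m Fs = mk_tree m' Gs" "length Fs = length Gs"
  shows "m = m' \<and> Fs = Gs"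
proof -
  have "Fs = Gs" if "\<forall>F\<in>set Fs. F = []" "\<forall>F\<in>set Gs. F = []"
    using that assms(2) by (metis replicate_eqI)
  moreover have "inj (Node None)" by (simp add: inj_on_def)
  ultimately show ?thesis using assms
    by (auto simp: mk_tree_def inj_map_eq_map split: if_splits)
qed

lemma good_root_le:
  assumes "good k True t"
  shows "the (label t) \<in> set (labels t)" "y \<in> set (labels t) \<Longrightarrow> the (label t) \<le> y"
proof -
  obtain m ts where "t = Node (Some m) ts" using assms by (cases t) auto
  with assms show "the (label t) \<in> set (labels t)" "y \<in> set (labels t) \<Longrightarrow> the (label t) \<le> y"
    by (auto simp: labels_Node less_imp_le)
qed

lemma flabels_mk_tree_Cons:
  "flabels (mk_tree m Fs # F) = insert m (\<Union>G\<in>set (F # Fs). flabels G)"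
  by (auto simp: flabels_def set_labels_mk_tree)

text \<open>The remaining trees \<open>F\<close> and the forests \<open>Fs\<close> below the first
  root enter symmetrically, which is the shape of the conditions in \<open>valid\<close>.\<close>

lemma good_forest_mk_tree_Cons:
  assumes "length Fs = k"
  shows "good_forest k (mk_tree m Fs # F) \<longleftrightarrow>
    (\<forall>G\<in>set (F # Fs). good_forest k G \<and> (\<forall>x\<in>flabels G. m < x)) \<and>
    sorted_wrt (\<lambda>G H. disjnt (flabels G) (flabels H)) (F # Fs)"
proof -
  \<comment> \<open>The root of an increasing tree carries its least label, so comparing
    \<open>m\<close> with the roots compares it with all labels.\<close>
  have gt: "(\<forall>T\<in>set F. m < the (label T)) \<longleftrightarrow> (\<forall>x\<in>flabels F. m < x)" if "\<forall>T\<in>set F. good k True T"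
    using that good_root_le[of k] unfolding flabels_def by (fastforce intro: less_le_trans)
  have disj: "(\<forall>T\<in>set F. disjnt (set (labels (mk_tree m Fs))) (set (labels T))) \<longleftrightarrow>
      (\<forall>G\<in>set Fs. disjnt (flabels F) (flabels G))" if "\<forall>x\<in>flabels F. m < x"
  proof -
    have "m \<notin> flabels F" using that by auto
    then have "m \<notin> set (labels T)" if "T \<in> set F" for T using that by (auto simp: flabels_def)
    then have "(\<forall>T\<in>set F. disjnt (set (labels (mk_tree m Fs))) (set (labels T))) \<longleftrightarrow>
        (\<forall>T\<in>set F. \<forall>G\<in>set Fs. disjnt (flabels G) (set (labels T)))"
      by (auto simp: set_labels_mk_tree disjnt_iff)
    also have "\<dots> \<longleftrightarrow> (\<forall>G\<in>set Fs. disjnt (flabels F) (flabels G))"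
      unfolding flabels_def[of F] disjnt_iff by blast
    finally show ?thesis .
  qed
  have "good_forest k (mk_tree m Fs # F) \<longleftrightarrow> good k True (mk_tree m Fs) \<and> good_forest k F \<and>
      (\<forall>T\<in>set F. disjnt (set (labels (mk_tree m Fs))) (set (labels T))) \<and>
      (\<forall>T\<in>set F. m < the (label T))"
    by (auto simp: good_forest_def)
  also have "\<dots> \<longleftrightarrow> good k True (mk_tree m Fs) \<and> good_forest k F \<and> (\<forall>x\<in>flabels F. m < x) \<and>
      (\<forall>G\<in>set Fs. disjnt (flabels F) (flabels G))"
    using gt disj good_forest_def by metis
  finally show ?thesis by (auto simp: good_mk_tree[OF assms])
qed

section \<open>From decompositions to forests\<close>

text \<open>This is the rule below an unlabeled node. Taking \<open>last\<close> after
  \<open>map\<close> keeps the recursive calls on elements of \<open>ds\<close>, even for an empty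
  list.\<close>

fun inner_forest :: "nat dtree \<Rightarrow> ptree list" where
  "inner_forest E = []"
| "inner_forest (N m ds) = mk_tree m (butlast (map inner_forest ds)) # last (map inner_forest ds)"

text \<open>This is the rule at the top level. Only the first subtree is treated by the same rule
  again; the others lie below the root and follow \<open>inner_forest\<close>.\<close>

fun outer_forest :: "nat dtree \<Rightarrow> ptree list" where
  "outer_forest E = []"
| "outer_forest (N m ds) = mk_tree m (map inner_forest (tl ds)) # hd (map outer_forest ds)"

lemma inner_forest_snoc: "inner_forest (N m (ds @ [d])) = mk_tree m (map inner_forest ds) # inner_forest d"
  by simp

lemma outer_forest_Cons: "outer_forest (N m (d # ds)) = mk_tree m (map inner_forest ds) # outer_forest d"
  by simp

text \<open>The conditions are symmetric in the subtrees. Moving the last one to the front makes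
  \<open>good_forest_mk_tree_Cons\<close> available for the inner rule too.\<close>

lemma valid_snoc:
  "valid k (N m (ds @ [d])) \<longleftrightarrow> valid k (N m (d # ds))"
  by (auto simp: sorted_wrt_append disjnt_sym)

lemma valid_N_cases:
  assumes "valid k (N m ds)"
  obtains e es where "ds = e # es" "length es = k"
  using assms by (cases ds) auto

lemma valid_N_cases_snoc:
  assumes "valid k (N m ds)"
  obtains e es where "ds = es @ [e]" "length es = k"
  using assms by (cases ds rule: rev_cases) auto

lemma good_inner_forest: "valid k d \<Longrightarrow> good_forest k (inner_forest d) \<and> flabels (inner_forest d) = dset d"
proof (induction d)
  case E
  then show ?case by (simp add: good_forest_def flabels_def)
next
  case (N m ds)
  obtain e es where ds: "ds = es @ [e]" "length es = k"
    using valid_N_cases_snoc[OF N.prems] by metis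
  have v: "valid k (N m (e # es))" using N.prems unfolding ds valid_snoc .
  have IH: "good_forest k (inner_forest d) \<and> flabels (inner_forest d) = dset d" if "d \<in> set (e # es)" for d
    using N.IH[of d] that v ds by auto
  then have "sorted_wrt (\<lambda>x y. disjnt (flabels (inner_forest x)) (flabels (inner_forest y))) es"
    using v by (auto intro: sorted_wrt_mono_rel[rotated])
  with v IH ds show ?case
    unfolding ds inner_forest_snoc
    by (simp add: good_forest_mk_tree_Cons flabels_mk_tree_Cons sorted_wrt_map)
qed

lemma good_outer_forest: "valid k d \<Longrightarrow> good_forest k (outer_forest d) \<and> flabels (outer_forest d) = dset d"
proof (induction d)
  case E
  then show ?case by (simp add: good_forest_def flabels_def)
next
  case (N m ds)
  obtain e es where ds: "ds = e # es" "length es = k"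
    using valid_N_cases[OF N.prems] by metis
  have v: "valid k (N m (e # es))" using N.prems unfolding ds .
  have IH: "good_forest k (outer_forest e) \<and> flabels (outer_forest e) = dset e"
    using N.IH[of e] v ds by auto
  have f: "good_forest k (inner_forest d) \<and> flabels (inner_forest d) = dset d" if "d \<in> set es" for d
    using good_inner_forest[of k d] that v by auto
  then have "sorted_wrt (\<lambda>x y. disjnt (flabels (inner_forest x)) (flabels (inner_forest y))) es"
    using v by (auto intro: sorted_wrt_mono_rel[rotated])
  with v IH f ds show ?case
    unfolding ds outer_forest_Cons
    by (simp add: good_forest_mk_tree_Cons flabels_mk_tree_Cons sorted_wrt_map)
qed

lemma map_inject_on:
  "map f xs = map f ys \<Longrightarrow> (\<And>x y. x \<in> set xs \<Longrightarrow> y \<in> set ys \<Longrightarrow> f x = f y \<Longrightarrow> x = y) \<Longrightarrow> xs = ys"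
proof (induction xs arbitrary: ys)
  case (Cons x xs)
  then show ?case by (cases ys) auto
qed simp

lemma inner_forest_inject: "valid k d \<Longrightarrow> valid k e \<Longrightarrow> inner_forest d = inner_forest e \<Longrightarrow> d = e"
proof (induction d arbitrary: e)
  case E
  then show ?case by (cases e) auto
next
  case (N m ds)
  then obtain m' es where e: "e = N m' es" by (cases e) auto
  obtain c cs where ds: "ds = cs @ [c]" "length cs = k"
    using valid_N_cases_snoc[OF N.prems(1)] by metis
  obtain b bs where es: "es = bs @ [b]" "length bs = k"
    using valid_N_cases_snoc N.prems(2) e by metis
  have eq: "mk_tree m (map inner_forest cs) = mk_tree m' (map inner_forest bs)" "inner_forest c = inner_forest b"
    using N.prems(3) unfolding e ds(1) es(1) inner_forest_snoc by simp_all
  then have "m = m'" "map inner_forest cs = map inner_forest bs"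
    using mk_tree_inject[OF eq(1)] ds es by auto
  moreover have "c = b" using N.IH[of c b] N.prems eq(2) by (simp add: e ds es)
  moreover have "cs = bs"
    using N.IH N.prems by (intro map_inject_on[OF \<open>map inner_forest cs = map inner_forest bs\<close>]) (auto simp: e ds es)
  ultimately show ?case by (simp add: e ds es)
qed

lemma outer_forest_inject: "valid k d \<Longrightarrow> valid k e \<Longrightarrow> outer_forest d = outer_forest e \<Longrightarrow> d = e"
proof (induction d arbitrary: e)
  case E
  then show ?case by (cases e) auto
next
  case (N m ds)
  then obtain m' es where e: "e = N m' es" by (cases e) auto
  obtain c cs where ds: "ds = c # cs" "length cs = k"
    using valid_N_cases[OF N.prems(1)] by metis
  obtain b bs where es: "es = b # bs" "length bs = k"
    using valid_N_cases N.prems(2) e by metis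
  have eq: "mk_tree m (map inner_forest cs) = mk_tree m' (map inner_forest bs)" "outer_forest c = outer_forest b"
    using N.prems(3) unfolding e ds(1) es(1) outer_forest_Cons by simp_all
  then have "m = m'" "map inner_forest cs = map inner_forest bs"
    using mk_tree_inject[OF eq(1)] ds es by auto
  moreover have "c = b" using N.IH[of c b] N.prems eq(2) by (simp add: e ds es)
  moreover have "cs = bs"
    using inner_forest_inject[of k] N.prems by (intro map_inject_on[OF \<open>map inner_forest cs = map inner_forest bs\<close>]) (auto simp: e ds es)
  ultimately show ?case by (simp add: e ds es)
qed

lemma finite_flabels: "finite (flabels F)"
  by (simp add: flabels_def)

text \<open>Each of the \<open>k + 1\<close> parts misses the label \<open>m\<close>, which yields
  the decreasing cardinality for the inductions proving surjectivity.\<close>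

lemma good_forest_cases:
  assumes "good_forest k F"
  obtains (Nil) "F = []"
  | (Cons) m Fs G where "F = mk_tree m Fs # G" "length Fs = k"
      "\<forall>H\<in>set (G # Fs). good_forest k H \<and> (\<forall>x\<in>flabels H. m < x) \<and> card (flabels H) < card (flabels F)"
      "sorted_wrt (\<lambda>G H. disjnt (flabels G) (flabels H)) (G # Fs)"
proof (cases F)
  case Nil
  then show ?thesis using that by blast
next
  case (Cons T G)
  then have "good k True T" using assms by (simp add: good_forest_def)
  then obtain m Fs where T: "length Fs = k" "T = mk_tree m Fs" using good_imp_mk_tree by blast
  have F: "F = mk_tree m Fs # G" using Cons T by simp
  have g: "\<forall>H\<in>set (G # Fs). good_forest k H \<and> (\<forall>x\<in>flabels H. m < x)"
    "sorted_wrt (\<lambda>G H. disjnt (flabels G) (flabels H)) (G # Fs)"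
    using assms unfolding F good_forest_mk_tree_Cons[OF T(1)] by auto
  have "card (flabels H) < card (flabels F)" if "H \<in> set (G # Fs)" for H
  proof (rule psubset_card_mono[OF finite_flabels])
    have "m \<notin> flabels H" using g(1) that by auto
    then show "flabels H \<subset> flabels F" using that unfolding F flabels_mk_tree_Cons by blast
  qed
  with F T g show ?thesis using that(2) by blast
qed

lemma inner_forest_surj: "good_forest k F \<Longrightarrow> \<exists>d. valid k d \<and> inner_forest d = F"
proof (induction "card (flabels F)" arbitrary: F rule: less_induct)
  case less
  from less.prems show ?case
  proof (cases rule: good_forest_cases)
    case Nil
    then show ?thesis by (intro exI[of _ E]) simp
  next
    case (Cons m Fs G)
    then have "\<forall>H\<in>set (G # Fs). \<exists>d. valid k d \<and> inner_forest d = H" using less.hyps by blast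
    then obtain f where f: "\<forall>H\<in>set (G # Fs). valid k (f H) \<and> inner_forest (f H) = H" by metis
    then have ds: "\<forall>H\<in>set (G # Fs). dset (f H) = flabels H" using good_inner_forest by metis
    have "valid k (N m (map f Fs @ [f G]))"
      unfolding valid_snoc using Cons f ds
      by (auto simp: sorted_wrt_map intro: sorted_wrt_mono_rel[rotated])
    moreover have "inner_forest (N m (map f Fs @ [f G])) = F"
      unfolding inner_forest_snoc using f Cons(1) by (simp add: comp_def map_idI)
    ultimately show ?thesis by blast
  qed
qed

text \<open>The forests below the first root are covered by \<open>inner_forest_surj\<close>; the
  induction is needed only for the remaining trees.\<close>

lemma outer_forest_surj: "good_forest k F \<Longrightarrow> \<exists>d. valid k d \<and> outer_forest d = F"
proof (induction "card (flabels F)" arbitrary: F rule: less_induct)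
  case less
  from less.prems show ?case
  proof (cases rule: good_forest_cases)
    case Nil
    then show ?thesis by (intro exI[of _ E]) simp
  next
    case (Cons m Fs G)
    then have "\<forall>H\<in>set Fs. \<exists>d. valid k d \<and> inner_forest d = H" using inner_forest_surj by (meson list.set_intros(2))
    then obtain f where f: "\<forall>H\<in>set Fs. valid k (f H) \<and> inner_forest (f H) = H" by metis
    then have ds: "\<forall>H\<in>set Fs. dset (f H) = flabels H" using good_inner_forest by metis
    obtain e where e: "valid k e" "outer_forest e = G" using less.hyps[of G] Cons(3) by auto
    then have "dset e = flabels G" using good_outer_forest by metis
    with Cons f ds e have "valid k (N m (e # map f Fs))"
      by (auto simp: sorted_wrt_map intro: sorted_wrt_mono_rel[rotated])
    moreover have "outer_forest (N m (e # map f Fs)) = F"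
      unfolding outer_forest_Cons using f e Cons(1) by (simp add: comp_def map_idI)
    ultimately show ?thesis by blast
  qed
qed

lemma bij_betw_outer_forest: "bij_betw outer_forest {d. valid k d \<and> dset d = {1..n}} (forests n k)"
  unfolding bij_betw_def
proof
  show "inj_on outer_forest {d. valid k d \<and> dset d = {1..n}}"
    using outer_forest_inject[of k] by (auto intro: inj_onI)
  show "outer_forest ` {d. valid k d \<and> dset d = {1..n}} = forests n k"
  proof (intro equalityI subsetI)
    fix F assume "F \<in> forests n k"
    then have F: "good_forest k F" "flabels F = {1..n}" by (simp_all add: forests_eq)
    then obtain d where "valid k d" "outer_forest d = F" using outer_forest_surj by blast
    moreover from this have "dset d = {1..n}" using F good_outer_forest[of k d] by simp
    ultimately show "F \<in> outer_forest ` {d. valid k d \<and> dset d = {1..n}}" by blast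
  next
    fix F assume "F \<in> outer_forest ` {d. valid k d \<and> dset d = {1..n}}"
    then obtain d where "valid k d" "dset d = {1..n}" "F = outer_forest d" by blast
    then show "F \<in> forests n k" using good_outer_forest[of k d] unfolding forests_eq by simp
  qed
qed

subsection \<open>Ascent-plateaus and labeled leaves\<close>

text \<open>For \<open>k \<ge> 1\<close> this is the condition under which \<open>ap\<close> counts
  the first index of \<open>x # w\<close>.\<close>

definition plateau :: "nat \<Rightarrow> nat \<Rightarrow> nat list \<Rightarrow> bool" where
  "plateau k x w \<longleftrightarrow> k \<le> length w \<and> x < hd w \<and> take k w = replicate k (hd w)"

lemma take_eq_replicate_iff:
  "k \<le> length w \<Longrightarrow> take k w = replicate k a \<longleftrightarrow> (\<forall>j<k. w ! j = a)"
  by (auto simp: list_eq_iff_nth_eq)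

lemma ap_Nil: "ap k [] = 0"
  by (simp add: ap_def)

lemma ap_Cons:
  assumes "k \<ge> 1"
  shows "ap k (x # w) = (if plateau k x w then 1 else 0) + ap k w"
proof -
  define P where "P u i \<longleftrightarrow> i + k < length u \<and> u ! i < u ! (i + 1) \<and>
      (\<forall>j\<in>{1..k}. u ! (i + j) = u ! (i + 1))" for u :: "nat list" and i
  have "P (x # w) 0 \<longleftrightarrow> plateau k x w"
  proof (cases w)
    case (Cons y v)
    have "(\<forall>j\<in>{1..k}. (x # w) ! j = y) \<longleftrightarrow> (\<forall>j<k. w ! j = y)"
    proof
      assume *: "\<forall>j\<in>{1..k}. (x # w) ! j = y"
      show "\<forall>j<k. w ! j = y"
        using *[rule_format, of "Suc _"] by auto
    next
      assume *: "\<forall>j<k. w ! j = y"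
      show "\<forall>j\<in>{1..k}. (x # w) ! j = y"
      proof
        fix j assume "j \<in> {1..k}"
        with * show "(x # w) ! j = y" by (cases j) auto
      qed
    qed
    moreover have "k \<le> length w \<Longrightarrow> take k w = replicate k y \<longleftrightarrow> (\<forall>j<k. w ! j = y)"
      by (rule take_eq_replicate_iff)
    ultimately show ?thesis unfolding P_def plateau_def by (auto simp: Cons)
  qed (use assms in \<open>simp add: P_def plateau_def\<close>)
  moreover have "P (x # w) (Suc i) \<longleftrightarrow> P w i" for i
    by (simp add: P_def)
  ultimately have eq: "{i. P (x # w) i} = (if plateau k x w then {0} else {}) \<union> Suc ` {i. P w i}"
    by (auto simp: image_iff) (metis not0_implies_Suc)+
  have fin: "finite {i. P w i}" by (rule finite_subset[of _ "{..<length w}"]) (auto simp: P_def)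
  have "card {i. P (x # w) i} = (if plateau k x w then 1 else 0) + card {i. P w i}"
    unfolding eq by (subst card_Un_disjoint) (auto simp: fin card_image)
  then show ?thesis by (simp add: ap_def P_def)
qed

text \<open>A constant block starting with \<open>hd w\<close> cannot reach the smaller letter
  \<open>m\<close>, so neither side holds when \<open>w\<close> is shorter than
  \<open>k\<close>.\<close>

lemma plateau_append:
  assumes "w \<noteq> []" "\<forall>y\<in>set w. m < y"
  shows "plateau k x (w @ m # v) \<longleftrightarrow> plateau k x w"
proof (cases "k \<le> length w")
  case True
  with assms(1) show ?thesis by (simp add: plateau_def)
next
  case False
  then have "m \<in> set (take k (w @ m # v))"
    by (cases "k - length w") auto
  moreover have "hd w \<noteq> m" using assms by (cases w) auto
  ultimately have "take k (w @ m # v) \<noteq> replicate k (hd (w @ m # v))"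
    using assms(1) by (metis hd_append2 in_set_replicate)
  with False show ?thesis by (simp add: plateau_def)
qed

text \<open>The step from \<open>w\<close> to \<open>m\<close> is a descent, and no constant block
  starting inside \<open>w\<close> crosses it.\<close>

lemma ap_append:
  assumes "k \<ge> 1" "w \<noteq> []" "\<forall>y\<in>set w. m < y"
  shows "ap k (w @ m # v) = ap k w + ap k (m # v)"
  using assms(2,3)
proof (induction w rule: list_nonempty_induct)
  case (single x)
  then have "\<not> plateau k x (m # v)" "\<not> plateau k x []"
    using assms(1) by (auto simp: plateau_def)
  with single show ?case using ap_Cons[OF assms(1), of x "m # v"] ap_Cons[OF assms(1), of x "[]"]
    by (simp add: ap_Nil)
next
  case (cons x xs)
  then have "plateau k x (xs @ m # v) \<longleftrightarrow> plateau k x xs" by (intro plateau_append) auto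
  with cons show ?case
    using ap_Cons[OF assms(1), of x "xs @ m # v"] ap_Cons[OF assms(1), of x xs] by simp
qed

lemma ap_Cons_append:
  assumes "k \<ge> 1" "w \<noteq> []" "\<forall>y\<in>set w. m < y"
  shows "ap k (x # w @ m # v) = ap k (x # w) + ap k (m # v)"
  using ap_append[OF assms, of v] plateau_append[OF assms(2,3), of k x v]
  by (simp add: ap_Cons[OF assms(1), of x])

text \<open>Each copy of \<open>m\<close> after the first follows an \<open>m\<close> or a larger
  letter and is not reached by an ascent, so the pieces contribute independently.\<close>

lemma ap_concat:
  assumes "k \<ge> 1" "\<forall>w\<in>set ws. \<forall>y\<in>set w. m < y"
  shows "ap k (concat (map ((#) m) ws)) = (\<Sum>w\<leftarrow>ws. ap k (m # w))"
  using assms(2)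
proof (induction ws)
  case (Cons w ws)
  show ?case
  proof (cases ws)
    case Nil
    then show ?thesis by simp
  next
    case ws: (Cons v vs)
    have np: "\<not> plateau k m (m # u)" "\<not> plateau k m []" for u using assms(1) by (auto simp: plateau_def)
    have "ap k (m # w @ concat (map ((#) m) ws)) = ap k (m # w) + ap k (concat (map ((#) m) ws))"
    proof (cases "w = []")
      case True
      then show ?thesis using np by (simp add: ws ap_Cons[OF assms(1), of m] ap_Nil)
    next
      case False
      then show ?thesis using Cons.prems by (simp add: ws ap_Cons_append[OF assms(1)])
    qed
    with Cons show ?thesis by simp
  qed
qed (simp add: ap_Nil)

text \<open>There are as many copies of \<open>m\<close> as pieces. They are adjacent iff nothing
  stands between them; the last piece comes after all of them and is free.\<close>

lemma take_concat_eq_replicate_iff: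
  assumes "\<forall>w\<in>set ws. m \<notin> set w"
  shows "take (length ws) (concat (map ((#) m) ws)) = replicate (length ws) m \<longleftrightarrow>
    (\<forall>w\<in>set (butlast ws). w = [])"
  using assms
proof (induction ws)
  case (Cons w ws)
  show ?case
  proof (cases "w = [] \<or> ws = []")
    case True
    with Cons show ?thesis by auto
  next
    case False
    then obtain a u v vs where "w = a # u" "ws = v # vs" by (metis neq_Nil_conv)
    with Cons.prems show ?thesis by auto
  qed
qed simp

lemma length_concat_Cons_ge: "length ws \<le> length (concat (map ((#) m) ws))"
  by (induction ws) auto

lemma ap_Cons_smaller:
  assumes "k \<ge> 1" "\<forall>y\<in>set w. x < y" "\<forall>y\<in>set w. x' < y"
  shows "ap k (x # w) = ap k (x' # w)"
proof -
  have "plateau k x w \<longleftrightarrow> plateau k x' w"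
    using assms by (cases w) (auto simp: plateau_def)
  then show ?thesis by (simp add: ap_Cons[OF assms(1)])
qed

text \<open>The first \<open>m\<close> begins the word or follows a larger letter, so no copy of
  \<open>m\<close> heads an ascent-plateau.\<close>

lemma ap_join:
  assumes "k \<ge> 1" "length ws = k" "\<forall>v\<in>set (w # ws). \<forall>y\<in>set v. m < y"
  shows "ap k (join m (w # ws)) = ap k w + (\<Sum>v\<leftarrow>ws. ap k (m # v))"
proof -
  obtain v vs where ws: "ws = v # vs" using assms by (cases ws) auto
  have "ap k (join m (w # ws)) = ap k w + ap k (concat (map ((#) m) ws))"
    using ap_append[OF assms(1), of w m] assms(3)
    by (cases "w = []") (auto simp: join_Cons ws ap_Nil)
  then show ?thesis using ap_concat[OF assms(1), of ws m] assms(3) by simp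
qed

text \<open>The letter \<open>x\<close> makes an ascent to the first \<open>m\<close> possible,
  namely when the first piece is empty; the plateau then has length \<open>k\<close> iff the next
  \<open>k - 1\<close> pieces are empty as well.\<close>

lemma ap_Cons_join:
  assumes "k \<ge> 1" "length ws = Suc k" "\<forall>v\<in>set ws. \<forall>y\<in>set v. m < y" "x < m"
  shows "ap k (x # join m ws) =
    (if \<forall>w\<in>set (butlast ws). w = [] then 1 else 0) + (\<Sum>v\<leftarrow>ws. ap k (m # v))"
proof -
  obtain w us where ws: "ws = w # us" using assms by (cases ws) auto
  then obtain v vs where us: "us = v # vs" using assms by (cases us) auto
  have c: "ap k (concat (map ((#) m) us)) = (\<Sum>v\<leftarrow>us. ap k (m # v))"
    using ap_concat[OF assms(1), of us m] assms(3) ws by simp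
  show ?thesis
  proof (cases "w = []")
    case True
    have "length us = k" using assms ws by simp
    have "plateau k x (concat (map ((#) m) us)) \<longleftrightarrow> (\<forall>w\<in>set (butlast us). w = [])"
      using take_concat_eq_replicate_iff[of us m] length_concat_Cons_ge[of us m] assms \<open>length us = k\<close>
      unfolding plateau_def by (fastforce simp: us ws)
    \<comment> \<open>This is the summand of the empty first piece.\<close>
    moreover have "ap k [m] = 0"
      using ap_Cons[OF assms(1), of m "[]"] assms(1) by (simp add: plateau_def ap_Nil)
    ultimately show ?thesis
      using c by (simp add: join_Cons ws True ap_Cons[OF assms(1), of x] us)
  next
    case False
    have "ap k (x # join m ws) = ap k (x # w) + ap k (concat (map ((#) m) us))"
      using ap_Cons_append[OF assms(1) False, of m x] assms(3) by (simp add: join_Cons ws us)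
    \<comment> \<open>The first piece is preceded by \<open>x\<close>, not by \<open>m\<close>; both
      are smaller than all its letters, which is all that matters.\<close>
    moreover have "ap k (x # w) = ap k (m # w)"
      using assms ws by (intro ap_Cons_smaller) (auto intro: less_trans)
    ultimately show ?thesis using c False by (simp add: ws us)
  qed
qed

section \<open>Labeled leaves, singletons and their match with ascent-plateaus\<close>

definition lleaf_tree :: "nat \<Rightarrow> ptree \<Rightarrow> nat" where
  "lleaf_tree d t = length (filter (\<lambda>(d, s). even d \<and> is_leaf s) (nodes_from d t))"

lemma lleaf_tree_Node:
  "lleaf_tree d (Node a ts) = (if even d \<and> ts = [] then 1 else 0) + (\<Sum>t\<leftarrow>ts. lleaf_tree (Suc d) t)"
  by (simp add: lleaf_tree_def is_leaf_def filter_concat length_concat comp_def)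

lemma lleaf_tree_parity: "even d = even d' \<Longrightarrow> lleaf_tree d t = lleaf_tree d' t"
proof (induction t arbitrary: d d')
  case (Node a ts)
  have "map (lleaf_tree (Suc d)) ts = map (lleaf_tree (Suc d')) ts"
    using Node by (intro map_cong[OF refl]) simp
  then show ?case using Node.prems by (simp add: lleaf_tree_Node del: map_eq_conv)
qed

lemma lleaf_eq: "lleaf F = (\<Sum>T\<leftarrow>F. lleaf_tree 0 T)"
  by (simp add: lleaf_def lleaf_tree_def)

lemma lleaf_tree_mk_tree:
  assumes "Fs \<noteq> []"
  shows "lleaf_tree 0 (mk_tree m Fs) = (if \<forall>F\<in>set Fs. F = [] then 1 else 0) + (\<Sum>F\<leftarrow>Fs. lleaf F)"
proof (cases "\<forall>F\<in>set Fs. F = []")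
  case True
  then have "(\<Sum>F\<leftarrow>Fs. lleaf F) = 0" by (auto simp: lleaf_eq sum_list_eq_0_iff)
  with True show ?thesis by (simp add: mk_tree_def lleaf_tree_Node)
next
  case False
  \<comment> \<open>The trees of \<open>F\<close> sit two levels below the root, which preserves
    parity, and the unlabeled node between is on an odd level and never counts.\<close>
  have "lleaf_tree (Suc 0) (Node None F) = lleaf F" for F
    using lleaf_tree_parity[of "Suc (Suc 0)" 0] by (simp add: lleaf_tree_Node lleaf_eq)
  then have "lleaf_tree 0 (Node (Some m) (map (Node None) Fs)) = (\<Sum>F\<leftarrow>Fs. lleaf F)"
    using assms by (simp add: lleaf_tree_Node comp_def)
  moreover have "mk_tree m Fs = Node (Some m) (map (Node None) Fs)"
    using False by (auto simp: mk_tree_def)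
  ultimately show ?thesis unfolding if_not_P[OF False] by simp
qed

lemma lleaf_Cons: "lleaf (T # F) = lleaf_tree 0 T + lleaf F"
  by (simp add: lleaf_eq)

lemma si_Cons: "si (mk_tree m Fs # F) = (if \<forall>F\<in>set Fs. F = [] then 1 else 0) + si F"
  by (auto simp: si_def is_leaf_def mk_tree_def)

lemma inner_forest_eq_Nil_iff: "inner_forest d = [] \<longleftrightarrow> d = E"
  by (cases d) auto

lemma words_greater:
  assumes "k \<ge> 1" "valid k (N m ds)"
  shows "\<forall>v\<in>set (map word ds). \<forall>y\<in>set v. m < y"
  using assms set_word[OF assms(1)] by auto

text \<open>By \<open>ap_Cons_join\<close>, the root letter heads an ascent-plateau iff all pieces
  but the last are empty, which is when the first tree is a single labeled leaf. The letter
  \<open>x\<close> is arbitrary because in the induction \<open>m\<close> takes its place.\<close>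

lemma ap_Cons_word:
  assumes "k \<ge> 1"
  shows "valid k d \<Longrightarrow> \<forall>y\<in>dset d. x < y \<Longrightarrow> ap k (x # word d) = lleaf (inner_forest d)"
proof (induction d arbitrary: x)
  case E
  show ?case using assms ap_Cons[OF assms, of x "[]"] by (simp add: plateau_def ap_Nil lleaf_def)
next
  case (N m ds)
  obtain e es where ds: "ds = es @ [e]" "length es = k"
    using valid_N_cases_snoc[OF N.prems(1)] by metis
  have IH: "ap k (m # word d) = lleaf (inner_forest d)" if "d \<in> set ds" for d
    using N.IH[OF that, of m] N.prems(1) that by auto
  have "(\<forall>w\<in>set (butlast (map word ds)). w = []) \<longleftrightarrow> (\<forall>d\<in>set es. d = E)"
    using N.prems(1) word_eq_Nil_iff[OF assms] by (auto simp: ds)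
  moreover have "(\<forall>F\<in>set (map inner_forest es). F = []) \<longleftrightarrow> (\<forall>d\<in>set es. d = E)"
    by (auto simp: inner_forest_eq_Nil_iff)
  moreover have "(\<Sum>v\<leftarrow>map word ds. ap k (m # v)) = (\<Sum>d\<leftarrow>ds. lleaf (inner_forest d))"
    using IH by (simp add: comp_def cong: map_cong)
  moreover have "length (map word ds) = Suc k" "x < m" using N.prems by simp_all
  ultimately have "ap k (x # word (N m ds)) =
      (if \<forall>F\<in>set (map inner_forest es). F = [] then 1 else 0) + (\<Sum>d\<leftarrow>ds. lleaf (inner_forest d))"
    using ap_Cons_join[OF assms, of "map word ds" m x] words_greater[OF assms N.prems(1)] by simp
  moreover have "map inner_forest es \<noteq> []" using ds assms by auto
  ultimately show ?case
    unfolding ds(1) inner_forest_snoc lleaf_Cons lleaf_tree_mk_tree[OF \<open>map inner_forest es \<noteq> []\<close>]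
    by (simp add: comp_def)
qed

text \<open>A first tree that is a singleton adds one to both \<open>si\<close> and
  \<open>lleaf\<close>, matching the fact that \<open>m\<close> heads no ascent-plateau here. The
  additive form avoids subtraction of natural numbers.\<close>

lemma ap_word:
  assumes "k \<ge> 1"
  shows "valid k d \<Longrightarrow> ap k (word d) + si (outer_forest d) = lleaf (outer_forest d)"
proof (induction d)
  case E
  show ?case by (simp add: ap_Nil lleaf_def si_def)
next
  case (N m ds)
  obtain e es where ds: "ds = e # es" "length es = k"
    using valid_N_cases[OF N.prems] by metis
  have "ap k (m # word d) = lleaf (inner_forest d)" if "d \<in> set es" for d
    using ap_Cons_word[OF assms, of d m] N.prems that by (auto simp: ds)
  then have "(\<Sum>v\<leftarrow>map word es. ap k (m # v)) = (\<Sum>F\<leftarrow>map inner_forest es. lleaf F)"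
    by (simp add: comp_def cong: map_cong)
  moreover have "map inner_forest es \<noteq> []" using ds assms by auto
  moreover have "ap k (word e) + si (outer_forest e) = lleaf (outer_forest e)" using N by (simp add: ds)
  ultimately show ?case
    using ap_join[OF assms, of "map word es" "word e" m] words_greater[OF assms N.prems] ds(2)
    unfolding ds(1) outer_forest_Cons lleaf_Cons si_Cons
    by (simp add: lleaf_tree_mk_tree)
qed

section \<open>Constant initial blocks and the last tree\<close>

lemma length_word_ge:
  assumes "k \<ge> 1" "valid k d" "d \<noteq> E"
  shows "k \<le> length (word d)"
proof -
  have "word d \<noteq> []" using word_eq_Nil_iff assms by blast
  then have "count_list (word d) (hd (word d)) = k"
    using stirling_word_word[OF assms(1,2)] by (simp add: stirling_word_def)
  then show ?thesis using count_le_length by metis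
qed

lemma outer_forest_eq_Nil_iff: "outer_forest d = [] \<longleftrightarrow> d = E"
  by (cases d) auto

text \<open>If all forests but the last are empty, the tree is a singleton or has leaves as its
  first \<open>k - 1\<close> children, according to whether the last forest is empty.\<close>

lemma mk_tree_children_leaves_iff:
  assumes "length Fs = k"
  shows "is_leaf (mk_tree m Fs) \<or> (\<forall>t\<in>set (take (k - 1) (children (mk_tree m Fs))). is_leaf t) \<longleftrightarrow>
    (\<forall>F\<in>set (butlast Fs). F = [])"
proof (cases "\<forall>F\<in>set Fs. F = []")
  case True
  then show ?thesis by (simp add: mk_tree_def is_leaf_def) (meson in_set_butlastD)
next
  case False
  then have "mk_tree m Fs = Node (Some m) (map (Node None) Fs)" "Fs \<noteq> []" by (auto simp: mk_tree_def)
  then show ?thesis using assms by (auto simp: is_leaf_def butlast_conv_take take_map)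
qed

text \<open>The induction follows the first subtrees. A nonempty one supplies both the first
  \<open>k\<close> letters and the last tree; once it is empty, \<open>m\<close> begins the word and
  is the root of the last tree.\<close>

lemma word_bar_iff:
  assumes "k \<ge> 1"
  shows "valid k d \<Longrightarrow> d \<noteq> E \<Longrightarrow> (\<forall>i<k. word d ! i = word d ! 0) \<longleftrightarrow>
    is_leaf (last (outer_forest d)) \<or> (\<forall>t\<in>set (take (k - 1) (children (last (outer_forest d)))). is_leaf t)"
proof (induction d)
  case (N m ds)
  obtain e es where ds: "ds = e # es" "length es = k"
    using valid_N_cases[OF N.prems(1)] by metis
  have w: "word (N m ds) = word e @ concat (map ((#) m) (map word es))"
    by (simp add: ds join_Cons)
  show ?case
  proof (cases "e = E")
    case True
    have g: "\<forall>v\<in>set (map word es). m \<notin> set v" using words_greater[OF assms N.prems(1)] ds by fastforce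
    have eq: "word (N m ds) = concat (map ((#) m) (map word es))" using w True by simp
    have len: "k \<le> length (word (N m ds))" using length_word_ge[OF assms N.prems] .
    have "word (N m ds) ! 0 = m" unfolding eq using ds assms by (cases es) auto
    then have "(\<forall>i<k. word (N m ds) ! i = word (N m ds) ! 0) \<longleftrightarrow> take k (word (N m ds)) = replicate k m"
      using take_eq_replicate_iff[OF len] by simp
    also have "\<dots> \<longleftrightarrow> (\<forall>w\<in>set (butlast (map word es)). w = [])"
      unfolding eq using take_concat_eq_replicate_iff[OF g] ds(2) by simp
    also have "\<dots> \<longleftrightarrow> (\<forall>F\<in>set (butlast (map inner_forest es)). F = [])"
    proof -
      have "word d = [] \<longleftrightarrow> inner_forest d = []" if "d \<in> set (butlast es)" for d
        using word_eq_Nil_iff[OF assms, of d] N.prems(1) in_set_butlastD[OF that]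
        by (simp add: inner_forest_eq_Nil_iff ds)
      then show ?thesis by (simp add: map_butlast[symmetric])
    qed
    also have "\<dots> \<longleftrightarrow> is_leaf (mk_tree m (map inner_forest es)) \<or>
        (\<forall>t\<in>set (take (k - 1) (children (mk_tree m (map inner_forest es)))). is_leaf t)"
      using mk_tree_children_leaves_iff[of "map inner_forest es" k m] ds by simp
    finally show ?thesis by (simp add: ds True)
  next
    case False
    have v: "valid k e" using N.prems ds by simp
    have "word (N m ds) ! i = word e ! i" if "i < k" for i
      using that length_word_ge[OF assms v False] w by (simp add: nth_append)
    then have "(\<forall>i<k. word (N m ds) ! i = word (N m ds) ! 0) \<longleftrightarrow> (\<forall>i<k. word e ! i = word e ! 0)"
      using assms by simp
    moreover have "last (outer_forest (N m ds)) = last (outer_forest e)"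
      using False by (simp add: ds outer_forest_eq_Nil_iff)
    ultimately show ?thesis using N.IH[of e] v False ds by simp
  qed
qed simp

theorem proposition3p3:
  fixes n k :: nat
  assumes "n \<ge> 1" and "k \<ge> 1"
  shows "\<exists>\<zeta> :: nat list \<Rightarrow> ptree list.
    bij_betw \<zeta> (stirling_perms n k) (forests n k) \<and>
    (\<forall>\<pi> \<in> stirling_perms n k. int (ap k \<pi>) = int (lleaf (\<zeta> \<pi>)) - int (si (\<zeta> \<pi>))) \<and>
    (\<forall>\<pi> \<in> stirling_perms n k. \<pi> \<in> stirling_perms_bar n k \<longleftrightarrow> \<zeta> \<pi> \<in> forests_bar n k)"
proof -
  \<comment> \<open>The decompositions with label set \<open>{1..n}\<close> index both sides, and
    \<open>\<zeta>\<close> is the passage from words to forests through them.\<close>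
  define D where "D = {d. valid k d \<and> dset d = {1..n}}"
  define \<zeta> where "\<zeta> = outer_forest \<circ> inv_into D word"
  have w: "bij_betw word D (stirling_perms n k)" and f: "bij_betw outer_forest D (forests n k)"
    using bij_betw_word[OF assms(2)] bij_betw_outer_forest by (simp_all add: D_def)
  have bij: "bij_betw \<zeta> (stirling_perms n k) (forests n k)"
    unfolding \<zeta>_def using bij_betw_trans[OF bij_betw_inv_into[OF w] f] .
  have "int (ap k \<pi>) = int (lleaf (\<zeta> \<pi>)) - int (si (\<zeta> \<pi>)) \<and>
      (\<pi> \<in> stirling_perms_bar n k \<longleftrightarrow> \<zeta> \<pi> \<in> forests_bar n k)" if "\<pi> \<in> stirling_perms n k" for \<pi>
  proof -
    have "\<pi> \<in> word ` D" using that bij_betw_imp_surj_on[OF w] by simp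
    then obtain d where d: "d \<in> D" "\<pi> = word d" by blast
    then have z: "\<zeta> \<pi> = outer_forest d" using w by (simp add: \<zeta>_def bij_betw_def)
    \<comment> \<open>Here \<open>n \<ge> 1\<close> ensures that the forest is nonempty and its last
      tree is meaningful.\<close>
    have v: "valid k d" "d \<noteq> E" using d assms(1) by (auto simp: D_def)
    have "\<zeta> \<pi> \<in> forests n k" using bij that by (auto simp: bij_betw_def)
    then show ?thesis
      using ap_word[OF assms(2) v(1)] word_bar_iff[OF assms(2) v] that
      unfolding stirling_perms_bar_def forests_bar_def d(2) z[unfolded d(2)] by auto
  qed
  with bij show ?thesis by blast
qed

end
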